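(* Let the norming constants $b_n$ satisfy $n(1-\Phi(b_n))=1$ and let $u_n(x)=b_nx^{b_n^{-2}}$ for $x>0$. Then for every $x>0$, $$\lim_{n\to\infty}b_n^2\Big(\Phi^n(u_n(x))-\exp(-x^{-1})\Big)=s(x)\exp(-x^{-1}),\qquad\text{where } s(x)=\big((\ln x)^2+\ln x\big)x^{-1}.$$
   Context: $\Phi$ denotes the standard normal distribution function and $\Phi^n(t)=(\Phi(t))^n$. The constants $b_n$ are considered for $n\ge3$, so that $b_n>0$, and $b_n\to\infty$. *)

theory Defs
  imports "HOL-Probability.Probability"
begin

definition Phi :: "real \<Rightarrow> real" where
  "Phi = cdf std_normal_distribution"

definition s :: "real \<Rightarrow> real" where
  "s x = ((ln x)\<^sup>2 + ln x) * x powi (-1)"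

end

theory Submission
  imports Defs "HOL-Real_Asymp.Real_Asymp"
begin

text \<open>
  Write \<open>c = ln x\<close> and \<open>p n = 1 - Phi (u n x)\<close>. Since \<open>n = 1 / (1 - Phi (b n))\<close>, the quantity
  \<open>n * p n\<close> is the quotient of the normal tails at \<open>v = t * exp (c / t\<^sup>2)\<close> and at \<open>t = b n\<close>, and the
  problem reduces to a two-term expansion of this quotient as \<open>t\<close> tends to infinity.

  With \<open>\<phi>\<close> the normal density and \<open>R t = t * (1 - Phi t) / \<phi> t\<close>, the quotient factors as
  \<open>(\<phi> v / \<phi> t) * (t / v) * (R v / R t)\<close>. The first two factors are elementary: from
  \<open>v\<^sup>2 / 2 = t\<^sup>2 / 2 + c + c\<^sup>2 / t\<^sup>2 + O(1 / t\<^sup>4)\<close> and \<open>t / v = 1 - c / t\<^sup>2 + O(1 / t\<^sup>4)\<close> their product is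
  \<open>exp (- c) * (1 - (c\<^sup>2 + c) / t\<^sup>2) + o(1 / t\<^sup>2)\<close> (\<open>density_quotient_expansion\<close>).
  The last factor contributes nothing at this order: \<open>R t = 1 - 1 / t\<^sup>2 + o(1 / t\<^sup>2)\<close>
  (\<open>scaled_mills_expansion\<close>), and because \<open>v\<close> is asymptotic to \<open>t\<close> the two corrections cancel
  (\<open>scaled_mills_quotient_expansion\<close>). Hence
  \<open>n * p n = 1 / x - s x / (b n)\<^sup>2 + o(1 / (b n)\<^sup>2)\<close>.

  It remains to pass to \<open>(1 - p n) ^ n = exp (n * ln (1 - p n))\<close>
  (\<open>power_one_minus_expansion\<close>). Replacing \<open>n * ln (1 - p n)\<close> by \<open>- n * p n\<close> costs \<open>O(1 / n)\<close>, which is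
  \<open>o(1 / (b n)\<^sup>2)\<close> since \<open>(b n)\<^sup>2 / n = (b n)\<^sup>2 * (1 - Phi (b n))\<close> tends to 0, and the
  linearisation of the exponential at \<open>- 1 / x\<close> turns the correction \<open>s x\<close> into \<open>s x * exp (- 1 / x)\<close>.
\<close>

section \<open>Limits of scaled errors\<close>

lemma tendsto_if_scaled_error_tendsto:
  fixes y r :: "'a \<Rightarrow> real"
  assumes "filterlim r at_top F" and "((\<lambda>n. r n * (y n - a)) \<longlongrightarrow> l) F"
  shows "(y \<longlongrightarrow> a) F"
proof -
  have "((\<lambda>n. (r n * (y n - a)) / r n) \<longlongrightarrow> 0) F"
    by (rule real_tendsto_divide_at_top[OF assms(2,1)])
  moreover have "\<forall>\<^sub>F n in F. r n > 0"
    using assms(1) by (auto simp: filterlim_at_top_dense)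
  then have "\<forall>\<^sub>F n in F. (r n * (y n - a)) / r n = y n - a"
    by eventually_elim simp
  ultimately have "((\<lambda>n. y n - a) \<longlongrightarrow> 0) F"
    by (rule Lim_transform_eventually)
  then show ?thesis by (simp add: LIM_zero_iff)
qed

text \<open>
  This is the delta method: \<open>f (y n) - f a\<close> equals \<open>g (y n) * (y n - a)\<close> for a function \<open>g\<close> that is
  continuous at \<open>a\<close> with value \<open>D\<close>, and \<open>y n\<close> tends to \<open>a\<close> because the scale \<open>r n\<close> tends to infinity.
\<close>
lemma delta_method:
  fixes f :: "real \<Rightarrow> real"
  assumes "DERIV f a :> D" and "filterlim r at_top F" and "((\<lambda>n. r n * (y n - a)) \<longlongrightarrow> l) F"
  shows "((\<lambda>n. r n * (f (y n) - f a)) \<longlongrightarrow> D * l) F"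
proof -
  obtain g where g: "\<And>z. f z - f a = g z * (z - a)" "isCont g a" "g a = D"
    using assms(1) by (auto simp: CARAT_DERIV)
  have "(y \<longlongrightarrow> a) F"
    by (rule tendsto_if_scaled_error_tendsto[OF assms(2,3)])
  then have "((\<lambda>n. g (y n)) \<longlongrightarrow> D) F"
    using g(2,3) isCont_tendsto_compose by fast
  from tendsto_mult[OF this assms(3)] show ?thesis
    by (simp add: g(1) mult_ac)
qed

section \<open>Bounds for the upper tail of the normal distribution\<close>

lemma upper_tail_eq_nn_integral:
  "ennreal (1 - Phi t) = (\<integral>\<^sup>+x. ennreal (std_normal_density x) * indicator {t..} x \<partial>lborel)"
proof -
  interpret real_distribution std_normal_distribution
    by (rule real_dist_normal_dist)
  have "1 - Phi t = prob (space std_normal_distribution - {..t})"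
    unfolding Phi_def cdf_def by (subst prob_compl) auto
  also have "space std_normal_distribution - {..t} = {t<..}"
    by auto
  finally have "ennreal (1 - Phi t) = emeasure std_normal_distribution {t<..}"
    by (simp add: emeasure_eq_measure)
  also have "\<dots> = (\<integral>\<^sup>+x. ennreal (std_normal_density x) * indicator {t<..} x \<partial>lborel)"
    by (subst emeasure_density) auto
  also have "\<dots> = (\<integral>\<^sup>+x. ennreal (std_normal_density x) * indicator {t..} x \<partial>lborel)"
    using AE_lborel_singleton[of t]
    by (intro nn_integral_cong_AE) (auto elim!: eventually_mono split: split_indicator)
  finally show ?thesis .
qed

lemma Phi_le_1: "Phi t \<le> 1"
proof -
  interpret real_distribution std_normal_distribution
    by (rule real_dist_normal_dist)
  show ?thesis unfolding Phi_def by (rule cdf_bounded_prob)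
qed

lemma Phi_mono: "t \<le> t' \<Longrightarrow> Phi t \<le> Phi t'"
proof -
  interpret real_distribution std_normal_distribution
    by (rule real_dist_normal_dist)
  show "t \<le> t' \<Longrightarrow> Phi t \<le> Phi t'" unfolding Phi_def by (rule cdf_nondecreasing)
qed

lemma DERIV_std_normal_density:
  "(std_normal_density has_real_derivative - x * std_normal_density x) (at x)"
  unfolding std_normal_density_def
  by (auto intro!: derivative_eq_intros simp: field_simps)

lemma nn_integral_tail_antideriv:
  assumes "\<And>x. t \<le> x \<Longrightarrow> (G has_real_derivative - g x) (at x)"
    and "\<And>x. t \<le> x \<Longrightarrow> 0 \<le> g x" and "g \<in> borel_measurable borel" and "(G \<longlongrightarrow> 0) at_top"
  shows "(\<integral>\<^sup>+x. ennreal (g x) * indicator {t..} x \<partial>lborel) = ennreal (G t)"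
proof -
  have "(\<integral>\<^sup>+x. ennreal (g x) * indicator {t..} x \<partial>lborel) = ennreal (0 - (- G t))"
    using assms by (intro nn_integral_FTC_atLeast[where F = "\<lambda>x. - G x"])
      (auto intro!: derivative_eq_intros tendsto_eq_intros)
  then show ?thesis by simp
qed

text \<open>
  Since the normal density \<open>\<phi>\<close> satisfies \<open>\<phi>' x = - x * \<phi> x\<close>, the function \<open>\<phi> * h\<close> has derivative
  \<open>- \<phi> x * (x * h x - h' x)\<close>. A choice of \<open>h\<close> for which \<open>x * h x - h' x\<close> stays below (or above) 1
  thus makes \<open>\<phi> t * h t\<close> a lower (or upper) bound for the upper tail at \<open>t\<close>.
\<close>
lemma nn_integral_tail_density_times:
  assumes "\<And>x. t \<le> x \<Longrightarrow> (h has_real_derivative h' x) (at x)"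
    and "\<And>x. t \<le> x \<Longrightarrow> 0 \<le> x * h x - h' x"
    and [measurable]: "h \<in> borel_measurable borel" "h' \<in> borel_measurable borel"
    and "((\<lambda>x. std_normal_density x * h x) \<longlongrightarrow> 0) at_top"
  shows "(\<integral>\<^sup>+x. ennreal (std_normal_density x * (x * h x - h' x)) * indicator {t..} x \<partial>lborel)
    = ennreal (std_normal_density t * h t)"
proof (rule nn_integral_tail_antideriv)
  fix x assume "t \<le> x"
  then show "((\<lambda>x. std_normal_density x * h x)
      has_real_derivative - (std_normal_density x * (x * h x - h' x))) (at x)"
    using DERIV_mult[OF DERIV_std_normal_density[of x] assms(1)[of x]] by (simp add: algebra_simps)
  show "0 \<le> std_normal_density x * (x * h x - h' x)"
    using assms(2)[OF \<open>t \<le> x\<close>] by simp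
next
  show "(\<lambda>x. std_normal_density x * (x * h x - h' x)) \<in> borel_measurable borel"
    by measurable
qed fact

text \<open>
  The functions \<open>h\<close> in this and the next bound are partial sums of the asymptotic series
  \<open>1 / x - 1 / x ^ 3 + 3 / x ^ 5 - \<dots>\<close>, the formal solution of \<open>x * h x - h' x = 1\<close>; stopping after
  a negative term leaves \<open>x * h x - h' x\<close> below 1, stopping after a positive one leaves it above 1.
  From 2 on, \<open>1 - 3 / x ^ 4\<close> is nonnegative, as the integration requires.
\<close>
lemma upper_tail_lower_bound:
  assumes "t \<ge> 2"
  shows "std_normal_density t * (1 / t - 1 / t ^ 3) \<le> 1 - Phi t"
proof -
  let ?h = "\<lambda>x. 1 / x - 1 / x ^ 3 :: real" and ?h' = "\<lambda>x. - 1 / x\<^sup>2 + 3 / x ^ 4 :: real"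
  have eq: "x * ?h x - ?h' x = 1 - 3 / x ^ 4" if "t \<le> x" for x
    using that assms by (simp add: field_simps eval_nat_numeral)
  have pow: "3 \<le> x ^ 4" if "t \<le> x" for x :: real
    using power_mono[of 2 x 4] that assms by simp
  have "ennreal (std_normal_density t * ?h t)
      = (\<integral>\<^sup>+x. ennreal (std_normal_density x * (x * ?h x - ?h' x)) * indicator {t..} x \<partial>lborel)"
  proof (rule nn_integral_tail_density_times[symmetric])
    fix x assume x: "t \<le> x"
    show "(?h has_real_derivative ?h' x) (at x)"
      using x assms by (auto intro!: derivative_eq_intros simp: field_simps eval_nat_numeral)
    show "0 \<le> x * ?h x - ?h' x"
      unfolding eq[OF x] using pow[OF x] x assms by simp
  next
    show "((\<lambda>x. std_normal_density x * ?h x) \<longlongrightarrow> 0) at_top"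
      unfolding std_normal_density_def by real_asymp
  qed measurable
  also have "\<dots> \<le> ennreal (1 - Phi t)"
    unfolding upper_tail_eq_nn_integral
  proof (intro nn_integral_mono)
    fix x
    show "ennreal (std_normal_density x * (x * ?h x - ?h' x)) * indicator {t..} x
        \<le> ennreal (std_normal_density x) * indicator {t..} x"
    proof (cases "t \<le> x")
      case True
      show ?thesis unfolding eq[OF True] by (intro mult_right_mono ennreal_leI mult_left_le) auto
    qed simp
  qed
  finally show ?thesis
    using Phi_le_1[of t] by (simp add: ennreal_le_iff)
qed

lemma upper_tail_upper_bound:
  assumes "t \<ge> 2"
  shows "1 - Phi t \<le> std_normal_density t * (1 / t - 1 / t ^ 3 + 3 / t ^ 5)"
proof -
  let ?h = "\<lambda>x. 1 / x - 1 / x ^ 3 + 3 / x ^ 5 :: real"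
    and ?h' = "\<lambda>x. - 1 / x\<^sup>2 + 3 / x ^ 4 - 15 / x ^ 6 :: real"
  have eq: "x * ?h x - ?h' x = 1 + 15 / x ^ 6" if "t \<le> x" for x
    using that assms by (simp add: field_simps eval_nat_numeral)
  have "ennreal (1 - Phi t)
      \<le> (\<integral>\<^sup>+x. ennreal (std_normal_density x * (x * ?h x - ?h' x)) * indicator {t..} x \<partial>lborel)"
    unfolding upper_tail_eq_nn_integral
  proof (intro nn_integral_mono)
    fix x
    show "ennreal (std_normal_density x) * indicator {t..} x
        \<le> ennreal (std_normal_density x * (x * ?h x - ?h' x)) * indicator {t..} x"
    proof (cases "t \<le> x")
      case True
      have "std_normal_density x \<le> std_normal_density x * (1 + 15 / x ^ 6)"
        by (simp add: distrib_left)
      then show ?thesis unfolding eq[OF True] by (intro mult_right_mono ennreal_leI) auto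
    qed simp
  qed
  also have "\<dots> = ennreal (std_normal_density t * ?h t)"
  proof (rule nn_integral_tail_density_times)
    fix x assume x: "t \<le> x"
    show "(?h has_real_derivative ?h' x) (at x)"
      using x assms by (auto intro!: derivative_eq_intros simp: field_simps eval_nat_numeral)
    show "0 \<le> x * ?h x - ?h' x"
      unfolding eq[OF x] by simp
  next
    show "((\<lambda>x. std_normal_density x * ?h x) \<longlongrightarrow> 0) at_top"
      unfolding std_normal_density_def by real_asymp
  qed measurable
  finally have le: "ennreal (1 - Phi t) \<le> ennreal (std_normal_density t * ?h t)" .
  have "1 / t ^ 3 \<le> 1 / t"
    using assms power_increasing[of 1 3 t] by (simp add: frac_le)
  then have "0 \<le> ?h t" using assms by simp
  with le show ?thesis by (simp add: ennreal_le_iff)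
qed

section \<open>The Mills ratio at infinity\<close>

text \<open>
  The Mills ratio \<open>(1 - Phi t) / \<phi> t\<close> decays like \<open>1 / t\<close>; the factor \<open>t\<close> normalises its limit to 1.
\<close>
definition scaled_mills :: "real \<Rightarrow> real" where
  "scaled_mills t = t * (1 - Phi t) / std_normal_density t"

lemma upper_tail_eq_scaled_mills:
  "t \<noteq> 0 \<Longrightarrow> 1 - Phi t = scaled_mills t * std_normal_density t / t"
  by (simp add: scaled_mills_def std_normal_density_def)

lemma scaled_mills_bounds:
  assumes "t \<ge> 2"
  shows "1 - 1 / t\<^sup>2 \<le> scaled_mills t" "scaled_mills t \<le> 1 - 1 / t\<^sup>2 + 3 / t ^ 4"
proof -
  have pos: "std_normal_density t > 0" by (simp add: normal_density_pos)
  have "(1 - 1 / t\<^sup>2) * std_normal_density t = t * (std_normal_density t * (1 / t - 1 / t ^ 3))"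
    using assms by (simp add: field_simps eval_nat_numeral)
  also have "\<dots> \<le> t * (1 - Phi t)"
    using upper_tail_lower_bound[OF assms] assms by (intro mult_left_mono) auto
  finally show "1 - 1 / t\<^sup>2 \<le> scaled_mills t"
    using pos by (simp only: scaled_mills_def pos_le_divide_eq)
  have "t * (1 - Phi t) \<le> t * (std_normal_density t * (1 / t - 1 / t ^ 3 + 3 / t ^ 5))"
    using upper_tail_upper_bound[OF assms] assms by (intro mult_left_mono) auto
  also have "\<dots> = (1 - 1 / t\<^sup>2 + 3 / t ^ 4) * std_normal_density t"
    using assms by (simp add: field_simps eval_nat_numeral)
  finally show "scaled_mills t \<le> 1 - 1 / t\<^sup>2 + 3 / t ^ 4"
    using pos by (simp only: scaled_mills_def pos_divide_le_eq)
qed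

lemma scaled_mills_expansion: "((\<lambda>t. t\<^sup>2 * (1 - scaled_mills t)) \<longlongrightarrow> 1) at_top"
proof (rule tendsto_sandwich)
  show "((\<lambda>t::real. 1 - 3 / t\<^sup>2) \<longlongrightarrow> 1) at_top" "((\<lambda>t::real. 1) \<longlongrightarrow> (1::real)) at_top"
    by (real_asymp, simp)
  show "\<forall>\<^sub>F t in at_top. 1 - 3 / t\<^sup>2 \<le> t\<^sup>2 * (1 - scaled_mills t)"
    using eventually_ge_at_top[of 2]
  proof eventually_elim
    case (elim t)
    have "1 - 3 / t\<^sup>2 = t\<^sup>2 * (1 - (1 - 1 / t\<^sup>2 + 3 / t ^ 4))"
      using elim by (simp add: field_simps eval_nat_numeral)
    also have "\<dots> \<le> t\<^sup>2 * (1 - scaled_mills t)"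
      using scaled_mills_bounds(2)[OF elim] by (intro mult_left_mono) auto
    finally show ?case .
  qed
  show "\<forall>\<^sub>F t in at_top. t\<^sup>2 * (1 - scaled_mills t) \<le> 1"
    using eventually_ge_at_top[of 2]
  proof eventually_elim
    case (elim t)
    have "t\<^sup>2 * (1 - scaled_mills t) \<le> t\<^sup>2 * (1 - (1 - 1 / t\<^sup>2))"
      using scaled_mills_bounds(1)[OF elim] by (intro mult_left_mono) auto
    also have "\<dots> = 1"
      using elim by (simp add: field_simps)
    finally show ?case .
  qed
qed

lemma scaled_mills_tendsto: "(scaled_mills \<longlongrightarrow> 1) at_top"
proof (rule tendsto_if_scaled_error_tendsto)
  show "filterlim (\<lambda>t::real. t\<^sup>2) at_top at_top" by real_asymp
  show "((\<lambda>t. t\<^sup>2 * (scaled_mills t - 1)) \<longlongrightarrow> - 1) at_top"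
    using tendsto_minus[OF scaled_mills_expansion] by (simp add: algebra_simps)
qed

text \<open>
  For \<open>v = t * exp (c / t\<^sup>2)\<close> the quotient \<open>v / t\<close> tends to 1, so both \<open>t\<^sup>2 * (1 - scaled_mills t)\<close> and
  \<open>t\<^sup>2 * (1 - scaled_mills v)\<close> tend to 1, and their difference vanishes in the limit.
\<close>
lemma scaled_mills_quotient_expansion:
  fixes c :: real
  shows "((\<lambda>t. t\<^sup>2 * (scaled_mills (t * exp (c / t\<^sup>2)) / scaled_mills t - 1)) \<longlongrightarrow> 0) at_top"
proof -
  define v where "v t = t * exp (c / t\<^sup>2)" for t
  have v_top: "filterlim v at_top at_top"
    unfolding v_def
  \<comment> \<open>The asymptotic expansion of \<open>exp (c / t\<^sup>2)\<close> is computed separately for each sign of \<open>c\<close>.\<close>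
  proof (cases c "0::real" rule: linorder_cases)
    case greater then show "filterlim (\<lambda>t. t * exp (c / t\<^sup>2)) at_top at_top" by real_asymp
  next
    case less then show "filterlim (\<lambda>t. t * exp (c / t\<^sup>2)) at_top at_top" by real_asymp
  qed (simp add: filterlim_ident)
  have "((\<lambda>t. c / t\<^sup>2) \<longlongrightarrow> 0) at_top" by real_asymp
  from tendsto_exp[OF this] have "((\<lambda>t. exp (c / t\<^sup>2)) \<longlongrightarrow> 1) at_top" by simp
  from tendsto_divide[OF filterlim_compose[OF scaled_mills_expansion v_top] tendsto_power[OF this, of 2]]
  have "((\<lambda>t. ((v t)\<^sup>2 * (1 - scaled_mills (v t))) / (exp (c / t\<^sup>2))\<^sup>2) \<longlongrightarrow> 1) at_top"
    by simp
  then have "((\<lambda>t. t\<^sup>2 * (1 - scaled_mills (v t))) \<longlongrightarrow> 1) at_top"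
    by (simp add: v_def power_mult_distrib)
  from tendsto_divide[OF tendsto_diff[OF scaled_mills_expansion this] scaled_mills_tendsto]
  have "((\<lambda>t. (t\<^sup>2 * (1 - scaled_mills t) - t\<^sup>2 * (1 - scaled_mills (v t))) / scaled_mills t)
      \<longlongrightarrow> 0) at_top"
    by simp
  moreover have "\<forall>\<^sub>F t in at_top. scaled_mills t > 0"
    using order_tendstoD(1)[OF scaled_mills_tendsto, of 0] by simp
  then have "\<forall>\<^sub>F t in at_top.
      (t\<^sup>2 * (1 - scaled_mills t) - t\<^sup>2 * (1 - scaled_mills (v t))) / scaled_mills t
      = t\<^sup>2 * (scaled_mills (v t) / scaled_mills t - 1)"
    by eventually_elim (simp add: field_simps)
  ultimately show ?thesis
    unfolding v_def[symmetric] by (rule Lim_transform_eventually)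
qed

section \<open>Quotients of upper tails\<close>

text \<open>
  With \<open>v = t * exp (c / t\<^sup>2)\<close>, the expression \<open>exp (t\<^sup>2 / 2 - v\<^sup>2 / 2) / exp (c / t\<^sup>2)\<close> is
  \<open>(\<phi> v / \<phi> t) * (t / v)\<close>. The exponent supplies the summand \<open>c\<^sup>2\<close> of the limit, and the factor
  \<open>t / v\<close> supplies \<open>c\<close>.
\<close>
lemma density_quotient_expansion:
  fixes c :: real
  shows "((\<lambda>t. t\<^sup>2 * (exp (t\<^sup>2 / 2 - (t * exp (c / t\<^sup>2))\<^sup>2 / 2) / exp (c / t\<^sup>2) - exp (- c)))
     \<longlongrightarrow> - (c\<^sup>2 + c) * exp (- c)) at_top"
proof (cases c "0 :: real" rule: linorder_cases)
  case greater then show ?thesis by (real_asymp simp: power2_eq_square algebra_simps)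
next
  case less then show ?thesis by (real_asymp simp: power2_eq_square algebra_simps)
qed simp

text \<open>
  In the factorisation \<open>A * B\<close> below, \<open>A\<close> carries the whole correction of order \<open>1 / t\<^sup>2\<close>, as \<open>B - 1\<close>
  is of smaller order.
\<close>
lemma upper_tail_quotient_expansion:
  fixes c :: real
  shows "((\<lambda>t. t\<^sup>2 * ((1 - Phi (t * exp (c / t\<^sup>2))) / (1 - Phi t) - exp (- c)))
     \<longlongrightarrow> - (c\<^sup>2 + c) * exp (- c)) at_top"
proof -
  define v where "v t = t * exp (c / t\<^sup>2)" for t
  define A where "A t = exp (t\<^sup>2 / 2 - (v t)\<^sup>2 / 2) / exp (c / t\<^sup>2)" for t
  define B where "B t = scaled_mills (v t) / scaled_mills t" for t
  have sq: "filterlim (\<lambda>t::real. t\<^sup>2) at_top at_top" by real_asymp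
  have B: "((\<lambda>t. t\<^sup>2 * (B t - 1)) \<longlongrightarrow> 0) at_top"
    unfolding B_def v_def by (rule scaled_mills_quotient_expansion)
  have A: "((\<lambda>t. t\<^sup>2 * (A t - exp (- c))) \<longlongrightarrow> - (c\<^sup>2 + c) * exp (- c)) at_top"
    unfolding A_def v_def by (rule density_quotient_expansion)
  from tendsto_add[OF tendsto_mult[OF A tendsto_if_scaled_error_tendsto[OF sq B]]
      tendsto_mult_left[OF B, of "exp (- c)"]]
  have "((\<lambda>t. t\<^sup>2 * (A t - exp (- c)) * B t + exp (- c) * (t\<^sup>2 * (B t - 1)))
      \<longlongrightarrow> - (c\<^sup>2 + c) * exp (- c)) at_top"
    by simp
  moreover have "\<forall>\<^sub>F t in at_top. (1 - Phi (v t)) / (1 - Phi t) = A t * B t"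
    using eventually_gt_at_top[of 0]
  proof eventually_elim
    case (elim t)
    have "std_normal_density (v t) / std_normal_density t = exp (t\<^sup>2 / 2 - (v t)\<^sup>2 / 2)"
      unfolding exp_diff by (simp add: std_normal_density_def exp_minus divide_simps)
    moreover have "v t \<noteq> 0" using elim by (simp add: v_def)
    ultimately show ?case
      using elim normal_density_pos[of 1 0 t]
      by (simp add: upper_tail_eq_scaled_mills A_def B_def field_simps)
         (simp add: v_def)
  qed
  then have "\<forall>\<^sub>F t in at_top. t\<^sup>2 * (A t - exp (- c)) * B t + exp (- c) * (t\<^sup>2 * (B t - 1))
     = t\<^sup>2 * ((1 - Phi (v t)) / (1 - Phi t) - exp (- c))"
    by eventually_elim (simp add: algebra_simps)
  ultimately show ?thesis
    unfolding v_def[symmetric] by (rule Lim_transform_eventually)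
qed

text \<open>
  The tail decays like \<open>\<phi> t / t\<close>, hence faster than any power of \<open>t\<close>. At \<open>t = b n\<close>, where the tail is
  \<open>1 / n\<close>, this makes \<open>(b n)\<^sup>2\<close> of smaller order than \<open>n\<close>.
\<close>
lemma sq_times_upper_tail_tendsto_0: "((\<lambda>t. t\<^sup>2 * (1 - Phi t)) \<longlongrightarrow> 0) at_top"
proof -
  have "((\<lambda>t. t * std_normal_density t) \<longlongrightarrow> 0) at_top"
    unfolding std_normal_density_def by real_asymp
  from tendsto_mult[OF this scaled_mills_tendsto]
  have "((\<lambda>t. t * std_normal_density t * scaled_mills t) \<longlongrightarrow> 0) at_top" by simp
  moreover have "\<forall>\<^sub>F t in at_top. t * std_normal_density t * scaled_mills t = t\<^sup>2 * (1 - Phi t)"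
    using eventually_gt_at_top[of 0]
    by eventually_elim (simp add: upper_tail_eq_scaled_mills power2_eq_square)
  ultimately show ?thesis by (rule Lim_transform_eventually)
qed

lemma Phi_less_1: "Phi t < 1"
proof -
  \<comment> \<open>The tail is nonincreasing, and from 2 on its lower bound is strictly positive.\<close>
  define m where "m = max t 2"
  have "0 < std_normal_density m * (1 / m - 1 / m ^ 3)"
    using power_strict_increasing[of 1 3 m]
    by (intro mult_pos_pos normal_density_pos) (auto simp: m_def intro!: divide_strict_left_mono)
  also have "\<dots> \<le> 1 - Phi m"
    by (rule upper_tail_lower_bound) (simp add: m_def)
  also have "\<dots> \<le> 1 - Phi t"
    using Phi_mono[of t m] by (simp add: m_def)
  finally show ?thesis by simp
qed

lemma filterlim_if_upper_tail_tendsto_0: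
  assumes "((\<lambda>n. 1 - Phi (y n)) \<longlongrightarrow> 0) F"
  shows "filterlim y at_top F"
  unfolding filterlim_at_top
proof
  fix M
  have "\<forall>\<^sub>F n in F. 1 - Phi (y n) < 1 - Phi M"
    using order_tendstoD(2)[OF assms, of "1 - Phi M"] Phi_less_1[of M] by simp
  then show "\<forall>\<^sub>F n in F. M \<le> y n"
  proof eventually_elim
    case (elim n)
    then show ?case using Phi_mono[of "y n" M] by linarith
  qed
qed

section \<open>Powers of the distribution function\<close>

text \<open>
  The product \<open>n * p n\<close> is bounded, so \<open>n * ln (1 - p n) = - n * p n + O(1 / n)\<close>, and by the
  assumption on \<open>r n / n\<close> this error is invisible at scale \<open>r n\<close>. The delta method for the
  exponential function then gives the limit, with \<open>exp (- a)\<close> as the derivative at \<open>- a\<close>.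
\<close>
lemma power_one_minus_expansion:
  fixes p r :: "nat \<Rightarrow> real"
  assumes r: "filterlim r at_top sequentially" "(\<lambda>n. r n / n) \<longlonglongrightarrow> 0"
    and p: "(\<lambda>n. r n * (n * p n - a)) \<longlonglongrightarrow> l"
  shows "(\<lambda>n. r n * ((1 - p n) ^ n - exp (- a))) \<longlonglongrightarrow> - l * exp (- a)"
proof -
  have np: "(\<lambda>n. n * p n) \<longlonglongrightarrow> a"
    by (rule tendsto_if_scaled_error_tendsto[OF r(1) p])
  have "(\<lambda>n. (n * p n) * (1 / real n)) \<longlonglongrightarrow> a * 0"
    by (intro tendsto_mult np) real_asymp
  moreover have "\<forall>\<^sub>F n in sequentially. (n * p n) * (1 / real n) = p n"
    using eventually_gt_at_top[of 0] by eventually_elim simp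
  ultimately have "p \<longlonglongrightarrow> 0"
    by (simp add: tendsto_cong)
  then have small: "\<forall>\<^sub>F n in sequentially. \<bar>p n\<bar> < 1 / 2"
    using order_tendstoD(2)[OF tendsto_rabs_zero, of p sequentially "1 / 2"] by simp
  have log_error: "(\<lambda>n. r n * (n * (ln (1 - p n) + p n))) \<longlonglongrightarrow> 0"
  proof (rule Lim_null_comparison)
    show "(\<lambda>n. 2 * (n * p n)\<^sup>2 * (r n / n)) \<longlonglongrightarrow> 0"
      by (rule tendsto_eq_intros np r refl | simp)+
    have "\<forall>\<^sub>F n in sequentially. r n > 0"
      using r(1) by (auto simp: filterlim_at_top_dense)
    with small eventually_gt_at_top[of 0]
    show "\<forall>\<^sub>F n in sequentially. norm (r n * (n * (ln (1 - p n) + p n))) \<le> 2 * (n * p n)\<^sup>2 * (r n / n)"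
    proof eventually_elim
      case (elim n)
      have "\<bar>ln (1 - p n) + p n\<bar> \<le> 2 * (p n)\<^sup>2"
        using abs_ln_one_plus_x_minus_x_bound[of "- p n"] elim by simp
      then have "r n * (n * \<bar>ln (1 - p n) + p n\<bar>) \<le> r n * (n * (2 * (p n)\<^sup>2))"
        using elim by (intro mult_left_mono) auto
      also have "\<dots> = 2 * (n * p n)\<^sup>2 * (r n / n)"
        using elim by (simp add: field_simps power2_eq_square)
      finally show ?case using elim by (simp add: abs_mult)
    qed
  qed
  have "(\<lambda>n. r n * (n * (ln (1 - p n) + p n)) - r n * (n * p n - a)) \<longlonglongrightarrow> 0 - l"
    by (intro tendsto_intros log_error p)
  then have "(\<lambda>n. r n * (n * ln (1 - p n) - (- a))) \<longlonglongrightarrow> - l"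
    by (simp add: algebra_simps)
  from delta_method[OF DERIV_exp r(1) this]
  have "(\<lambda>n. r n * (exp (n * ln (1 - p n)) - exp (- a))) \<longlonglongrightarrow> - l * exp (- a)"
    by (simp add: mult.commute)
  moreover have "\<forall>\<^sub>F n in sequentially.
      r n * (exp (n * ln (1 - p n)) - exp (- a)) = r n * ((1 - p n) ^ n - exp (- a))"
    using small by eventually_elim (simp add: exp_of_nat_mult)
  ultimately show ?thesis by (rule Lim_transform_eventually)
qed

theorem lemma4p1:
  fixes b :: "nat \<Rightarrow> real" and u :: "nat \<Rightarrow> real \<Rightarrow> real"
  assumes b: "\<And>n. n \<ge> 3 \<Longrightarrow> real n * (1 - Phi (b n)) = 1"
  assumes u: "\<And>n x. n \<ge> 3 \<Longrightarrow> x > 0 \<Longrightarrow> u n x = b n * x powr (b n powi (-2))"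
  shows "\<forall>x>0. (\<lambda>n. (b n)\<^sup>2 * (Phi (u n x) ^ n - exp (- (x powi (-1)))))
           \<longlonglongrightarrow> s x * exp (- (x powi (-1)))"
proof (intro allI impI)
  fix x :: real assume x: "x > 0"
  have tail_b: "\<forall>\<^sub>F n in sequentially. 1 - Phi (b n) = 1 / n"
    using eventually_ge_at_top[of 3]
    by eventually_elim (use b in \<open>force simp: field_simps\<close>)
  have "(\<lambda>n. 1 / real n) \<longlonglongrightarrow> 0" by real_asymp
  then have "(\<lambda>n. 1 - Phi (b n)) \<longlonglongrightarrow> 0"
    using tendsto_cong[OF tail_b] by simp
  then have b_top: "filterlim b at_top sequentially"
    by (rule filterlim_if_upper_tail_tendsto_0)
  have sq_top: "filterlim (\<lambda>t::real. t\<^sup>2) at_top at_top" by real_asymp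
  have b2_top: "filterlim (\<lambda>n. (b n)\<^sup>2) at_top sequentially"
    by (rule filterlim_compose[OF sq_top b_top])
  have "(\<lambda>n. (b n)\<^sup>2 * (1 - Phi (b n))) \<longlonglongrightarrow> 0"
    by (rule filterlim_compose[OF sq_times_upper_tail_tendsto_0 b_top])
  moreover have "\<forall>\<^sub>F n in sequentially. (b n)\<^sup>2 * (1 - Phi (b n)) = (b n)\<^sup>2 / n"
    using tail_b by eventually_elim simp
  ultimately have b2_n: "(\<lambda>n. (b n)\<^sup>2 / n) \<longlonglongrightarrow> 0"
    by (rule Lim_transform_eventually)
  have exp_neg_ln: "exp (- ln x) = x powi (-1)"
    using x by (simp add: exp_minus power_int_minus)
  have "(\<lambda>n. (b n)\<^sup>2 * ((1 - Phi (b n * exp (ln x / (b n)\<^sup>2))) / (1 - Phi (b n)) - exp (- ln x)))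
      \<longlonglongrightarrow> - ((ln x)\<^sup>2 + ln x) * exp (- ln x)"
    by (rule filterlim_compose[OF upper_tail_quotient_expansion b_top])
  moreover have "\<forall>\<^sub>F n in sequentially.
      (b n)\<^sup>2 * ((1 - Phi (b n * exp (ln x / (b n)\<^sup>2))) / (1 - Phi (b n)) - exp (- ln x))
      = (b n)\<^sup>2 * (n * (1 - Phi (u n x)) - x powi (-1))"
    using tail_b eventually_ge_at_top[of 3]
  proof eventually_elim
    case (elim n)
    have "u n x = b n * exp (ln x / (b n)\<^sup>2)"
      using u[OF elim(2) x] x by (simp add: powr_def power_int_minus field_simps)
    then show ?case
      using elim by (simp add: exp_neg_ln mult.commute)
  qed
  ultimately have "(\<lambda>n. (b n)\<^sup>2 * (n * (1 - Phi (u n x)) - x powi (-1))) \<longlonglongrightarrow> - s x"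
    unfolding s_def minus_mult_left exp_neg_ln by (rule Lim_transform_eventually)
  from power_one_minus_expansion[OF b2_top b2_n this]
  show "(\<lambda>n. (b n)\<^sup>2 * (Phi (u n x) ^ n - exp (- (x powi (-1)))))
           \<longlonglongrightarrow> s x * exp (- (x powi (-1)))"
    by simp
qed

end
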